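(* Let $H$ be a complex Hilbert space and let $T\in\mathcal{B}(H)$. Then $$M(T)\geq 0\iff T\geq 0.$$
   Context: $\mathcal{B}(H)$ is the algebra of bounded linear operators on $H$, and $A\geq 0$ means that $A$ is a positive (semidefinite, self-adjoint) operator. For $T\in\mathcal{B}(H)$, $|T|=(T^*T)^{1/2}$, and the polar decomposition $T=V|T|$ is the canonical one: $V$ is the unique partial isometry with $T=V|T|$ and $\ker(V)=\ker(T)$. The mean transform of $T$ is $M(T)=\frac12(T+|T|V)$. *)

theory Defs
  imports "HOL-Analysis.Analysis"
begin

text \<open>The inner product is linear in its first argument. Building on \<^class>\<open>real_normed_vector\<close>
  makes the library's topology available; the axiom \<open>scaleR_scaleC\<close> identifies its real scalar
  multiplication with the restriction of the complex one.\<close>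

class complex_inner = real_normed_vector +
  fixes scaleC :: "complex \<Rightarrow> 'a \<Rightarrow> 'a"  (infixr "*\<^sub>C" 75)
    and cinner :: "'a \<Rightarrow> 'a \<Rightarrow> complex"
  assumes scaleC_add_right: "c *\<^sub>C (x + y) = c *\<^sub>C x + c *\<^sub>C y"
    and scaleC_add_left: "(c + d) *\<^sub>C x = c *\<^sub>C x + d *\<^sub>C x"
    and scaleC_scaleC: "c *\<^sub>C d *\<^sub>C x = (c * d) *\<^sub>C x"
    and scaleR_scaleC: "r *\<^sub>R x = complex_of_real r *\<^sub>C x"
    and cinner_commute: "cinner x y = cnj (cinner y x)"
    and cinner_add_left: "cinner (x + y) z = cinner x z + cinner y z"
    and cinner_scaleC_left: "cinner (c *\<^sub>C x) y = c * cinner x y"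
    and cinner_ge_zero: "0 \<le> Re (cinner x x)"
    and cinner_eq_zero_iff: "cinner x x = 0 \<longleftrightarrow> x = 0"
    and norm_eq_sqrt_cinner: "norm x = sqrt (Re (cinner x x))"

class complex_hilbert = complex_inner + complete_space

definition bounded_clinear :: "('a::complex_inner \<Rightarrow> 'a) \<Rightarrow> bool" where
  "bounded_clinear T \<longleftrightarrow> bounded_linear T \<and> (\<forall>c x. T (c *\<^sub>C x) = c *\<^sub>C T x)"

text \<open>The definite descriptions below are meant for bounded operators on a Hilbert space, where
  the object described exists and is unique.\<close>

definition cadjoint :: "('a::complex_hilbert \<Rightarrow> 'a) \<Rightarrow> ('a \<Rightarrow> 'a)" where
  "cadjoint T = (THE S. \<forall>x y. cinner (T x) y = cinner x (S y))"

text \<open>Self-adjointness forces \<open>cinner (A x) x\<close> to be real, so comparing its real part with \<open>0\<close> loses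
  nothing.\<close>

definition positive_op :: "('a::complex_hilbert \<Rightarrow> 'a) \<Rightarrow> bool" where
  "positive_op A \<longleftrightarrow>
     bounded_clinear A \<and> cadjoint A = A \<and> (\<forall>x. 0 \<le> Re (cinner (A x) x))"

definition sqrt_op :: "('a::complex_hilbert \<Rightarrow> 'a) \<Rightarrow> ('a \<Rightarrow> 'a)" where
  "sqrt_op A = (THE B. positive_op B \<and> B \<circ> B = A)"

definition abs_op :: "('a::complex_hilbert \<Rightarrow> 'a) \<Rightarrow> ('a \<Rightarrow> 'a)" where
  "abs_op T = sqrt_op (cadjoint T \<circ> T)"

definition ker_op :: "('a::complex_hilbert \<Rightarrow> 'a) \<Rightarrow> 'a set" where
  "ker_op T = {x. T x = 0}"

text \<open>A partial isometry is isometric on the orthogonal complement of its kernel.\<close>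

definition partial_isometry :: "('a::complex_hilbert \<Rightarrow> 'a) \<Rightarrow> bool" where
  "partial_isometry V \<longleftrightarrow>
     bounded_clinear V \<and> (\<forall>x. (\<forall>z\<in>ker_op V. cinner x z = 0) \<longrightarrow> norm (V x) = norm x)"

definition polar_isometry :: "('a::complex_hilbert \<Rightarrow> 'a) \<Rightarrow> ('a \<Rightarrow> 'a)" where
  "polar_isometry T =
     (THE V. partial_isometry V \<and> T = V \<circ> abs_op T \<and> ker_op V = ker_op T)"

definition mean_transform :: "('a::complex_hilbert \<Rightarrow> 'a) \<Rightarrow> ('a \<Rightarrow> 'a)" where
  "mean_transform T = (\<lambda>x. (1/2) *\<^sub>C (T x + abs_op T (polar_isometry T x)))"

end

theory Submission
  imports Defs
begin

text \<open>Let \<open>P = abs_op T\<close>, let \<open>V\<close> be the polar isometry, so that \<open>T = V P\<close>, and recall that \<open>V\<close>, \<open>T\<close>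
  and \<open>P\<close> have the same kernel. Twice the mean transform is \<open>V P + P V\<close>.

  If it is positive, it is self-adjoint, which says that \<open>K = V - V\<^sup>*\<close> anticommutes with \<open>P\<close>. Then \<open>K\<close>
  commutes with \<open>P\<^sup>2\<close> and therefore with its square root \<open>P\<close>, so \<open>K P = P K = 0\<close>; comparing kernels,
  \<open>K = 0\<close>. A self-adjoint partial isometry has the eigenvalues \<open>1\<close>, \<open>0\<close> and \<open>- 1\<close> only. On an
  eigenvector for \<open>- 1\<close> the form of \<open>V P + P V\<close> is \<open>- 2\<close> times the form of \<open>P\<close>; positivity of both
  forms puts that eigenvector into the kernel of \<open>P\<close>, on which \<open>V\<close> vanishes. So \<open>V\<close> is the orthogonal
  projection onto the closure of the range of \<open>P\<close>, and \<open>T = V P = P\<close> is positive.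
  Conversely, a positive \<open>T\<close> equals its own mean transform.

  The objects in this argument are defined by description, and most of the work is to construct
  them: the adjoint by the Riesz representation (\<open>cinner_cadjoint\<close>), the unique positive square root
  of \<open>T\<^sup>* T\<close> together with its commutation property (\<open>positive_op_abs_op\<close>, \<open>abs_op_commute\<close>) by a
  fixed-point iteration (\<open>sqrt_iter\<close>), and the polar isometry
  (\<open>partial_isometry_polar\<close>) as the closure of the map \<open>P y \<mapsto> T y\<close>, extended by zero.\<close>

section \<open>Complex inner product spaces\<close>

lemma cinner_add_right: "cinner x (y + z) = cinner x y + cinner x z"
  by (metis cinner_commute cinner_add_left complex_cnj_add)

lemma cinner_scaleC_right: "cinner x (c *\<^sub>C y) = cnj c * cinner x y"
  by (metis cinner_commute cinner_scaleC_left complex_cnj_mult)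

lemma cinner_self: "cinner x x = of_real ((norm x)\<^sup>2)"
proof -
  have "Im (cinner x x) = 0"
    using cinner_commute[of x x] by (metis Reals_cnj_iff complex_is_Real_iff)
  then show ?thesis
    using cinner_ge_zero[of x] by (simp add: complex_eq_iff norm_eq_sqrt_cinner)
qed

lemma scaleR_half_eq_scaleC: "(1/2) *\<^sub>C x = (1/2::real) *\<^sub>R (x::'a::complex_inner)"
  by (simp add: scaleR_scaleC)

lemma cinner_left_additive: "Modules.additive (\<lambda>x. cinner x y)"
  by unfold_locales (rule cinner_add_left)

lemma cinner_right_additive: "Modules.additive (\<lambda>y. cinner x y)"
  by unfold_locales (rule cinner_add_right)

lemmas cinner_diff_left = Modules.additive.diff[OF cinner_left_additive]
lemmas cinner_diff_right = Modules.additive.diff[OF cinner_right_additive]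
lemmas cinner_minus_left = Modules.additive.minus[OF cinner_left_additive]
lemmas cinner_minus_right = Modules.additive.minus[OF cinner_right_additive]
lemmas cinner_zero_left [simp] = Modules.additive.zero[OF cinner_left_additive]
lemmas cinner_zero_right [simp] = Modules.additive.zero[OF cinner_right_additive]

lemma cinner_scaleR_left: "cinner (r *\<^sub>R x) y = of_real r * cinner x y"
  by (simp add: scaleR_scaleC cinner_scaleC_left)

lemma cinner_scaleR_right: "cinner x (r *\<^sub>R y) = of_real r * cinner x y"
  by (simp add: scaleR_scaleC cinner_scaleC_right)

lemma norm_diff_square: "(norm (x - y))\<^sup>2 = (norm x)\<^sup>2 + (norm y)\<^sup>2 - 2 * Re (cinner x y)"
proof -
  have "complex_of_real ((norm (x - y))\<^sup>2)
      = of_real ((norm x)\<^sup>2) + of_real ((norm y)\<^sup>2) - (cinner x y + cnj (cinner x y))"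
    by (simp only: cinner_self[symmetric] cinner_commute[of y x, symmetric])
       (simp add: cinner_diff_left cinner_diff_right)
  then show ?thesis
    by (simp add: complex_eq_iff)
qed

lemma parallelogram_complex_inner:
  fixes x y :: "'a::complex_inner"
  shows "(norm (x - y))\<^sup>2 + (norm (x + y))\<^sup>2 = 2 * (norm x)\<^sup>2 + 2 * (norm y)\<^sup>2"
  using norm_diff_square[of x y] norm_diff_square[of x "- y"]
  by (simp add: cinner_minus_right)

lemma norm_scaleC: "norm (c *\<^sub>C x) = cmod c * norm x"
proof -
  have "cinner (c *\<^sub>C x) (c *\<^sub>C x) = (c * cnj c) * cinner x x"
    by (simp add: cinner_scaleC_left cinner_scaleC_right)
  then have "complex_of_real ((norm (c *\<^sub>C x))\<^sup>2) = of_real ((cmod c * norm x)\<^sup>2)"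
    by (simp only: cinner_self complex_norm_square[symmetric] of_real_mult[symmetric] power_mult_distrib)
  then show ?thesis
    by (simp only: of_real_eq_iff) (simp add: power2_eq_iff_nonneg)
qed

lemma scaleC_zero_right [simp]: "c *\<^sub>C 0 = (0::'a::complex_inner)"
  using norm_scaleC[of c "0::'a"] by simp

text \<open>The coefficient \<open>cinner x y / (norm y)\<^sup>2\<close> is that of the orthogonal projection of \<open>x\<close> onto the
  line through \<open>y\<close>, so this is Pythagoras' theorem.\<close>

lemma norm_diff_line_projection:
  assumes "y \<noteq> 0"
  shows "(norm (x - (cinner x y / of_real ((norm y)\<^sup>2)) *\<^sub>C y))\<^sup>2
    = (norm x)\<^sup>2 - (cmod (cinner x y))\<^sup>2 / (norm y)\<^sup>2"
proof -
  define c where "c = cinner x y / of_real ((norm y)\<^sup>2)"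
  have n: "cmod c = cmod (cinner x y) / (norm y)\<^sup>2"
    by (simp add: c_def norm_divide norm_power)
  have "cinner x (c *\<^sub>C y) = of_real ((cmod (cinner x y))\<^sup>2 / (norm y)\<^sup>2)"
    unfolding cinner_scaleC_right c_def of_real_divide complex_norm_square by (simp add: mult.commute)
  then have "Re (cinner x (c *\<^sub>C y)) = (cmod (cinner x y))\<^sup>2 / (norm y)\<^sup>2"
    by (metis Re_complex_of_real)
  moreover have "(norm (c *\<^sub>C y))\<^sup>2 = (cmod (cinner x y))\<^sup>2 / (norm y)\<^sup>2"
    using assms by (simp add: norm_scaleC n power2_eq_square field_simps)
  ultimately show ?thesis
    unfolding c_def[symmetric] norm_diff_square by simp
qed

lemma cinner_Cauchy_Schwarz: "cmod (cinner x y) \<le> norm x * norm y"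
proof (cases "y = 0")
  case False
  then have "(cmod (cinner x y))\<^sup>2 / (norm y)\<^sup>2 \<le> (norm x)\<^sup>2"
    using norm_diff_line_projection[OF False, of x]
    by (metis diff_ge_0_iff_ge zero_le_power2)
  then have "(cmod (cinner x y))\<^sup>2 \<le> (norm x * norm y)\<^sup>2"
    using False by (simp add: divide_le_eq power_mult_distrib)
  then show ?thesis
    by (rule power2_le_imp_le) simp
qed simp

lemma bounded_bilinear_cinner: "bounded_bilinear cinner"
proof
  show "\<exists>K. \<forall>x y. cmod (cinner x y) \<le> norm x * norm y * K"
    by (rule exI[of _ 1]) (simp add: cinner_Cauchy_Schwarz)
qed (simp_all add: cinner_add_left cinner_add_right cinner_scaleR_left cinner_scaleR_right
      scaleR_conv_of_real)

lemmas tendsto_cinner = bounded_bilinear.tendsto[OF bounded_bilinear_cinner]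

lemma cinner_extensionality:
  assumes "\<And>z. cinner x z = cinner y z"
  shows "x = y"
  using assms[of "x - y"] by (metis cinner_diff_left cinner_eq_zero_iff right_minus_eq)

lemma cinner_extensionality_right:
  assumes "\<And>z. cinner z x = cinner z y"
  shows "x = y"
  by (rule cinner_extensionality) (metis assms cinner_commute)

section \<open>Orthogonal projections and the Riesz representation\<close>

text \<open>Almost minimisers of the distance to \<open>S\<close> form a Cauchy sequence by the parallelogram law;
  that the limit cannot be improved along any line makes the remainder orthogonal to \<open>S\<close>. As \<open>S\<close>
  need not be closed, the foot point \<open>p\<close> is only a limit of elements of \<open>S\<close>.\<close>

lemma orthogonal_projection_exists:
  fixes S :: "'a::complex_hilbert set"
  assumes "0 \<in> S" and add: "\<And>x y. x \<in> S \<Longrightarrow> y \<in> S \<Longrightarrow> x + y \<in> S"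
    and scale: "\<And>c x. x \<in> S \<Longrightarrow> c *\<^sub>C x \<in> S"
  obtains s p where "\<And>n::nat. s n \<in> S" "s \<longlonglongrightarrow> p" "\<And>z. z \<in> S \<Longrightarrow> cinner (x - p) z = 0"
proof -
  define D where "D = (\<lambda>s. (norm (x - s))\<^sup>2) ` S"
  define d where "d = Inf D"
  have ne: "D \<noteq> {}" and bdd: "bdd_below D"
    using \<open>0 \<in> S\<close> unfolding D_def by (auto intro: bdd_belowI[of _ 0])
  have d_le: "d \<le> (norm (x - s))\<^sup>2" if "s \<in> S" for s
    unfolding d_def using that bdd by (auto simp: D_def intro: cInf_lower)
  have "\<exists>s\<in>S. (norm (x - s))\<^sup>2 < d + 1 / (real n + 1)" for n
    using cInf_lessD[OF ne, of "d + 1 / (real n + 1)"] unfolding d_def D_def by fastforce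
  then obtain s where s: "\<And>n. s n \<in> S" "\<And>n. (norm (x - s n))\<^sup>2 < d + 1 / (real n + 1)"
    by metis
  have close: "(norm (s m - s n))\<^sup>2 \<le> 2 / (real m + 1) + 2 / (real n + 1)" for m n
  proof -
    have mid: "(1/2) *\<^sub>C (s m + s n) \<in> S"
      using add scale s by blast
    have "(x - s m) + (x - s n) = 2 *\<^sub>R (x - (1/2) *\<^sub>C (s m + s n))"
      by (simp add: scaleR_half_eq_scaleC algebra_simps scaleR_2)
    then have "(norm ((x - s m) + (x - s n)))\<^sup>2 = 4 * (norm (x - (1/2) *\<^sub>C (s m + s n)))\<^sup>2"
      by (simp add: power_mult_distrib)
    then have "(norm ((x - s m) + (x - s n)))\<^sup>2 \<ge> 4 * d"
      using d_le[OF mid] by linarith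
    moreover have "(x - s m) - (x - s n) = s n - s m"
      by simp
    ultimately show ?thesis
      using parallelogram_complex_inner[of "x - s m" "x - s n"] s(2)[of m] s(2)[of n]
      by (simp add: norm_minus_commute)
  qed
  have "Cauchy s"
  proof (rule metric_CauchyI)
    fix e :: real assume "e > 0"
    obtain N where N: "4 / e\<^sup>2 < real N"
      using reals_Archimedean2 by blast
    have "dist (s m) (s n) < e" if "m \<ge> N" "n \<ge> N" for m n
    proof -
      have "2 / (real k + 1) < e\<^sup>2 / 2" if "k \<ge> N" for k
      proof -
        have "4 / e\<^sup>2 < real k + 1"
          using N that by linarith
        then show ?thesis
          using \<open>e > 0\<close> by (simp add: field_simps)
      qed
      then have "2 / (real m + 1) + 2 / (real n + 1) < e\<^sup>2"
        using that by (metis add_strict_mono field_sum_of_halves)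
      then have "(norm (s m - s n))\<^sup>2 < e\<^sup>2"
        using close[of m n] by linarith
      then show ?thesis
        using \<open>e > 0\<close> by (simp add: dist_norm power_less_imp_less_base)
    qed
    then show "\<exists>M. \<forall>m\<ge>M. \<forall>n\<ge>M. dist (s m) (s n) < e"
      by blast
  qed
  then obtain p where p: "s \<longlonglongrightarrow> p"
    using Cauchy_convergent convergent_def by blast
  have "(\<lambda>n. (norm (x - s n))\<^sup>2) \<longlonglongrightarrow> (norm (x - p))\<^sup>2"
    by (intro tendsto_intros p)
  moreover have "(\<lambda>n. d + 1 / (real n + 1)) \<longlonglongrightarrow> d + 0"
    by (intro tendsto_add tendsto_const)
       (use LIMSEQ_inverse_real_of_nat in \<open>simp add: inverse_eq_divide add.commute\<close>)
  ultimately have p_le: "(norm (x - p))\<^sup>2 \<le> d"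
    using s(2) by (intro LIMSEQ_le) (auto intro: less_imp_le)
  have "cinner (x - p) z = 0" if "z \<in> S" for z
  proof (cases "z = 0")
    case False
    define w where "w = (cinner (x - p) z / of_real ((norm z)\<^sup>2)) *\<^sub>C z"
    have "(\<lambda>n. (norm (x - (s n + w)))\<^sup>2) \<longlonglongrightarrow> (norm (x - (p + w)))\<^sup>2"
      by (intro tendsto_intros p)
    then have "d \<le> (norm (x - (p + w)))\<^sup>2"
      by (rule LIMSEQ_le_const) (use d_le add s scale that in \<open>auto simp: w_def\<close>)
    then have "(cmod (cinner (x - p) z))\<^sup>2 / (norm z)\<^sup>2 \<le> 0"
      using norm_diff_line_projection[OF False, of "x - p"] p_le
      by (simp add: w_def diff_diff_eq)
    then show ?thesis
      using False by (simp add: divide_le_0_iff)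
  qed simp
  then show thesis
    using that s(1) p by blast
qed

lemma bounded_clinear_zero: "bounded_clinear T \<Longrightarrow> T 0 = 0"
  unfolding bounded_clinear_def by (simp add: linear_simps)

lemma bounded_clinear_add: "bounded_clinear T \<Longrightarrow> T (x + y) = T x + T y"
  unfolding bounded_clinear_def by (simp add: linear_simps)

lemma bounded_clinear_diff: "bounded_clinear T \<Longrightarrow> T (x - y) = T x - T y"
  unfolding bounded_clinear_def by (simp add: linear_simps)

lemma bounded_clinear_scaleC: "bounded_clinear T \<Longrightarrow> T (c *\<^sub>C x) = c *\<^sub>C T x"
  unfolding bounded_clinear_def by simp

lemma bounded_clinear_tendsto: "bounded_clinear T \<Longrightarrow> s \<longlonglongrightarrow> p \<Longrightarrow> (\<lambda>n. T (s n)) \<longlonglongrightarrow> T p"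
  unfolding bounded_clinear_def by (blast intro: bounded_linear.tendsto)

lemma bounded_clinearI:
  assumes "\<And>x y. T (x + y) = T x + T y" and "\<And>c x. T (c *\<^sub>C x) = c *\<^sub>C T x"
    and "\<And>x. norm (T x) \<le> norm x * K"
  shows "bounded_clinear T"
  unfolding bounded_clinear_def
  using assms by (auto intro!: bounded_linear_intro[where K = K] simp: scaleR_scaleC)

text \<open>The kernel of a nonzero functional has an orthogonal vector \<open>u\<close> outside of it; since
  \<open>f h *\<^sub>C u - f u *\<^sub>C h\<close> lies in the kernel for each \<open>h\<close>, a multiple of \<open>u\<close> represents \<open>f\<close>.\<close>

lemma Riesz_representation:
  fixes f :: "'a::complex_hilbert \<Rightarrow> complex"
  assumes f: "bounded_linear f" and scale: "\<And>c x. f (c *\<^sub>C x) = c * f x"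
  obtains y where "\<And>x. f x = cinner x y"
proof (cases "\<forall>x. f x = 0")
  case True
  then show ?thesis using that[of 0] by simp
next
  case False
  then obtain x where x: "f x \<noteq> 0" by blast
  have "0 \<in> {z. f z = 0}" and "\<And>x y. x \<in> {z. f z = 0} \<Longrightarrow> y \<in> {z. f z = 0} \<Longrightarrow> x + y \<in> {z. f z = 0}"
    and "\<And>c x. x \<in> {z. f z = 0} \<Longrightarrow> c *\<^sub>C x \<in> {z. f z = 0}"
    using f by (simp_all add: linear_simps scale)
  then obtain s p where s: "\<And>n::nat. f (s n) = 0" "s \<longlonglongrightarrow> p"
    and orth: "\<And>z. f z = 0 \<Longrightarrow> cinner (x - p) z = 0"
    by (rule orthogonal_projection_exists[of _ x]) auto
  define u where "u = x - p"
  have "(\<lambda>n. f (s n)) \<longlonglongrightarrow> f p"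
    by (rule bounded_linear.tendsto[OF f s(2)])
  then have "f p = 0"
    using s(1) by (simp add: LIMSEQ_const_iff)
  then have u: "f u \<noteq> 0"
    using x f by (simp add: u_def linear_simps)
  then have "u \<noteq> 0"
    using f by (auto simp: linear_simps)
  show ?thesis
  proof (rule that)
    fix h
    have "f (f h *\<^sub>C u - f u *\<^sub>C h) = 0"
      using f by (simp add: linear_simps scale)
    then have "cinner (f h *\<^sub>C u - f u *\<^sub>C h) u = 0"
      using orth cinner_commute[of _ u] by (simp add: u_def)
    then have "f h * cinner u u = f u * cinner h u"
      by (simp add: cinner_diff_left cinner_scaleC_left)
    then show "f h = cinner h (cnj (f u / cinner u u) *\<^sub>C u)"
      using \<open>u \<noteq> 0\<close> by (simp add: cinner_scaleC_right cinner_eq_zero_iff field_simps)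
  qed
qed

section \<open>Adjoints and positive operators\<close>

lemma cadjoint_eqI:
  assumes "\<And>x y. cinner (T x) y = cinner x (S y)"
  shows "cadjoint T = S"
  unfolding cadjoint_def
proof (rule the_equality)
  fix R assume R: "\<forall>x y. cinner (T x) y = cinner x (R y)"
  show "R = S"
    by (rule ext, rule cinner_extensionality_right) (metis R assms)
qed (simp add: assms)

lemma cinner_cadjoint:
  assumes T: "bounded_clinear T"
  shows "cinner (T x) y = cinner x (cadjoint T y)"
proof -
  have "\<exists>z. \<forall>x. cinner (T x) y = cinner x z" for y
  proof (rule Riesz_representation)
    show "bounded_linear (\<lambda>x. cinner (T x) y)"
      using T unfolding bounded_clinear_def
      by (intro bounded_linear_compose[OF bounded_bilinear.bounded_linear_left[OF bounded_bilinear_cinner]]) simp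
    show "cinner (T (c *\<^sub>C x)) y = c * cinner (T x) y" for c x
      by (simp add: bounded_clinear_scaleC[OF T] cinner_scaleC_left)
  qed blast
  then obtain S where S: "\<And>x y. cinner (T x) y = cinner x (S y)"
    by metis
  show ?thesis
    using cadjoint_eqI[OF S] S by simp
qed

lemma cinner_cadjoint_left:
  "bounded_clinear T \<Longrightarrow> cinner (cadjoint T x) y = cinner x (T y)"
  by (metis cinner_cadjoint cinner_commute)

lemma norm_cadjoint_le:
  assumes T: "bounded_clinear T" and K: "\<And>x. norm (T x) \<le> K * norm x"
  shows "norm (cadjoint T y) \<le> K * norm y"
proof (cases "cadjoint T y = 0")
  case True
  have "0 \<le> K * norm y"
    using K[of y] norm_ge_zero order_trans by blast
  then show ?thesis using True by simp
next
  case False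
  let ?z = "cadjoint T y"
  have "of_real ((norm ?z)\<^sup>2) = cinner (T ?z) y"
    by (simp add: cinner_cadjoint[OF T] cinner_self)
  then have "(norm ?z)\<^sup>2 = cmod (cinner (T ?z) y)"
    by (metis abs_power2 norm_of_real)
  also have "\<dots> \<le> K * norm ?z * norm y"
    using cinner_Cauchy_Schwarz[of "T ?z" y] K[of ?z]
    by (meson mult_right_mono norm_ge_zero order_trans)
  finally show ?thesis
    using False by (simp add: power2_eq_square mult_ac)
qed

lemma bounded_clinear_bound:
  assumes "bounded_clinear T"
  obtains K where "K > 0" "\<And>x. norm (T x) \<le> K * norm x"
  using bounded_linear.pos_bounded[of T] assms unfolding bounded_clinear_def
  by (metis mult.commute)

lemma bounded_clinear_cadjoint:
  assumes T: "bounded_clinear T"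
  shows "bounded_clinear (cadjoint T)"
proof -
  obtain K where K: "\<And>x. norm (T x) \<le> K * norm x"
    using bounded_clinear_bound[OF T] by blast
  show ?thesis
  proof (rule bounded_clinearI)
    show "cadjoint T (x + y) = cadjoint T x + cadjoint T y" for x y
      by (rule cinner_extensionality) (simp add: cinner_cadjoint_left[OF T] cinner_add_left)
    show "cadjoint T (c *\<^sub>C x) = c *\<^sub>C cadjoint T x" for c x
      by (rule cinner_extensionality) (simp add: cinner_cadjoint_left[OF T] cinner_scaleC_left)
    show "norm (cadjoint T x) \<le> norm x * K" for x
      using norm_cadjoint_le[OF T K] by (simp add: mult.commute)
  qed
qed

lemma positive_op_bounded_clinear: "positive_op A \<Longrightarrow> bounded_clinear A"
  unfolding positive_op_def by simp

lemma positive_op_cinner: "positive_op A \<Longrightarrow> cinner (A x) y = cinner x (A y)"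
  unfolding positive_op_def by (metis cinner_cadjoint)

lemma positive_op_nonneg: "positive_op A \<Longrightarrow> 0 \<le> Re (cinner (A x) x)"
  unfolding positive_op_def by simp

lemma positive_opI:
  assumes "bounded_clinear A" "\<And>x y. cinner (A x) y = cinner x (A y)"
    "\<And>x. 0 \<le> Re (cinner (A x) x)"
  shows "positive_op A"
  unfolding positive_op_def using assms cadjoint_eqI by blast

text \<open>Moving from \<open>y\<close> a small distance in the direction \<open>- A y\<close> changes the quadratic form to first
  order by \<open>- 2 * t * (norm (A y))\<^sup>2\<close>; it would become negative unless \<open>A y = 0\<close>.\<close>

lemma positive_op_form_zero:
  assumes A: "positive_op A" and zero: "Re (cinner (A y) y) \<le> 0"
  shows "A y = 0"
proof (rule ccontr)
  assume "A y \<noteq> 0"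
  define a where "a = (norm (A y))\<^sup>2"
  define b where "b = Re (cinner (A (A y)) (A y))"
  have "a > 0" "b \<ge> 0"
    using \<open>A y \<noteq> 0\<close> positive_op_nonneg[OF A] by (auto simp: a_def b_def)
  \<comment> \<open>small enough for the second-order term \<open>t\<^sup>2 * b\<close> to stay below \<open>2 * t * a\<close>, also when \<open>b = 0\<close>\<close>
  define t where "t = a / (b + 1)"
  have "0 < a * b + a * 2"
    using \<open>a > 0\<close> \<open>b \<ge> 0\<close> by (simp add: add_nonneg_pos)
  then have "t > 0" "t * b < 2 * a"
    using \<open>a > 0\<close> \<open>b \<ge> 0\<close> by (simp_all add: t_def field_simps)
  have lin: "A (y - t *\<^sub>R A y) = A y - t *\<^sub>R A (A y)"
    using positive_op_bounded_clinear[OF A]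
    by (simp add: bounded_clinear_diff bounded_clinear_scaleC scaleR_scaleC)
  have "Re (cinner (A y) (A y)) = a" "Re (cinner (A (A y)) y) = a"
    using positive_op_cinner[OF A, of "A y" y] by (simp_all add: a_def cinner_self)
  then have "Re (cinner (A (y - t *\<^sub>R A y)) (y - t *\<^sub>R A y))
      = Re (cinner (A y) y) - t * (2 * a - t * b)"
    unfolding lin
    by (simp add: cinner_diff_left cinner_diff_right cinner_scaleR_left cinner_scaleR_right
        b_def algebra_simps)
  moreover have "t * (2 * a - t * b) > 0"
    using \<open>t > 0\<close> \<open>t * b < 2 * a\<close> by simp
  ultimately show False
    using zero positive_op_nonneg[OF A, of "y - t *\<^sub>R A y"] by linarith
qed

section \<open>Square roots of positive operators\<close>

text \<open>If \<open>B\<close> is a contraction and \<open>Y\<close> solves \<open>Y = (B + Y\<^sup>2) / 2\<close>, then \<open>(1 - Y)\<^sup>2 = 1 - B\<close>.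
  Iterating this equation from \<open>0\<close> solves it: every iterate is a polynomial in \<open>B\<close> with nonnegative
  coefficients, so the same iteration with the number \<open>1\<close> in place of \<open>B\<close> dominates its norm, and
  dominates the increments as well.\<close>

fun sqrt_iter :: "('a::real_vector \<Rightarrow> 'a) \<Rightarrow> nat \<Rightarrow> 'a \<Rightarrow> 'a" where
  "sqrt_iter B 0 = (\<lambda>x. 0)"
| "sqrt_iter B (Suc n) = (\<lambda>x. (1/2) *\<^sub>R (B x + sqrt_iter B n (sqrt_iter B n x)))"

fun sqrt_iter_bound :: "nat \<Rightarrow> real" where
  "sqrt_iter_bound 0 = 0"
| "sqrt_iter_bound (Suc n) = (1 + (sqrt_iter_bound n)\<^sup>2) / 2"

lemma sqrt_iter_bound_range: "0 \<le> sqrt_iter_bound n \<and> sqrt_iter_bound n \<le> 1"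
  by (induction n) (auto simp: power_le_one)

lemma incseq_sqrt_iter_bound: "incseq sqrt_iter_bound"
proof (rule incseq_SucI)
  fix n
  show "sqrt_iter_bound n \<le> sqrt_iter_bound (Suc n)"
    using zero_le_power2[of "1 - sqrt_iter_bound n"] by (simp add: power2_eq_square algebra_simps)
qed

lemma linear_sqrt_iter: "linear B \<Longrightarrow> linear (sqrt_iter B n)"
proof (induction n)
  case 0
  then show ?case by (simp add: linear_iff)
next
  case (Suc n)
  then show ?case by (simp add: linear_iff scaleR_add_right algebra_simps)
qed

lemma sqrt_iter_commute:
  assumes "linear C" and "\<And>x. C (B x) = B (C x)"
  shows "C (sqrt_iter B n x) = sqrt_iter B n (C x)"
  by (induction n arbitrary: x) (simp_all add: assms linear_0 linear_cmul linear_add)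

lemma sqrt_iter_commute_sqrt_iter:
  assumes "linear B"
  shows "sqrt_iter B m (sqrt_iter B n x) = sqrt_iter B n (sqrt_iter B m x)"
proof (rule sqrt_iter_commute[OF linear_sqrt_iter[OF assms]])
  show "sqrt_iter B m (B x) = B (sqrt_iter B m x)" for x
    by (rule sqrt_iter_commute[symmetric]) (use assms in auto)
qed

lemma norm_sqrt_iter_le:
  fixes B :: "'a::real_normed_vector \<Rightarrow> 'a"
  assumes contr: "\<And>x. norm (B x) \<le> norm x"
  shows "norm (sqrt_iter B n x) \<le> sqrt_iter_bound n * norm x"
proof (induction n arbitrary: x)
  case (Suc n)
  let ?b = "sqrt_iter_bound n"
  have "norm (sqrt_iter B n (sqrt_iter B n x)) \<le> ?b * (?b * norm x)"
    using Suc[of x] Suc[of "sqrt_iter B n x"] sqrt_iter_bound_range[of n]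
    by (meson mult_left_mono order_trans)
  then have "norm (B x + sqrt_iter B n (sqrt_iter B n x)) \<le> norm x + ?b * (?b * norm x)"
    using contr[of x] norm_triangle_ineq[of "B x" "sqrt_iter B n (sqrt_iter B n x)"] by linarith
  then show ?case
    by (simp only: sqrt_iter.simps norm_scaleR sqrt_iter_bound.simps)
       (simp add: power2_eq_square field_simps)
qed simp

text \<open>As the iterates commute, the difference of consecutive squares factors.\<close>

lemma norm_sqrt_iter_step:
  fixes B :: "'a::real_normed_vector \<Rightarrow> 'a"
  assumes lin: "linear B" and contr: "\<And>x. norm (B x) \<le> norm x"
  shows "norm (sqrt_iter B (Suc n) x - sqrt_iter B n x)
    \<le> (sqrt_iter_bound (Suc n) - sqrt_iter_bound n) * norm x"
proof (induction n arbitrary: x)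
  case 0
  then show ?case using contr[of x] by simp
next
  case (Suc n)
  define Y Z where "Y = sqrt_iter B n" and "Z = sqrt_iter B (Suc n)"
  define a b where "a = sqrt_iter_bound n" and "b = sqrt_iter_bound (Suc n)"
  note linY = linear_sqrt_iter[OF lin, of n, folded Y_def]
  note linZ = linear_sqrt_iter[OF lin, of "Suc n", folded Z_def]
  have comm: "Y (Z x) = Z (Y x)"
    unfolding Y_def Z_def by (rule sqrt_iter_commute_sqrt_iter[OF lin])
  have Z: "Z x = (1/2) *\<^sub>R (B x + Y (Y x))" for x
    by (simp add: Y_def Z_def)
  have W: "sqrt_iter B (Suc (Suc n)) x = (1/2) *\<^sub>R (B x + Z (Z x))"
    by (subst sqrt_iter.simps(2)) (simp only: Z_def)
  have "sqrt_iter B (Suc (Suc n)) x - Z x = (1/2) *\<^sub>R (Z (Z x) - Y (Y x))"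
    unfolding W Z[of x] by (simp add: algebra_simps)
  also have "Z (Z x) - Y (Y x) = Z (Z x + Y x) - Y (Z x + Y x)"
    by (simp add: linear_add[OF linY] linear_add[OF linZ] comm)
  finally have "norm (sqrt_iter B (Suc (Suc n)) x - Z x) = norm (Z (Z x + Y x) - Y (Z x + Y x)) / 2"
    by simp
  also have "\<dots> \<le> (b - a) * norm (Z x + Y x) / 2"
    using Suc[of "Z x + Y x"] by (simp add: Y_def Z_def a_def b_def)
  also have "\<dots> \<le> (b - a) * ((b + a) * norm x) / 2"
  proof -
    have "norm (Z x + Y x) \<le> (b + a) * norm x"
      using norm_triangle_ineq[of "Z x" "Y x"] norm_sqrt_iter_le[OF contr, of n x]
        norm_sqrt_iter_le[OF contr, of "Suc n" x]
      unfolding Y_def Z_def a_def b_def by (simp only: distrib_right)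
    moreover have "0 \<le> b - a"
      using incseq_SucD[OF incseq_sqrt_iter_bound] by (simp add: a_def b_def)
    ultimately show ?thesis
      by (simp add: mult_left_mono divide_right_mono)
  qed
  also have "\<dots> = (sqrt_iter_bound (Suc (Suc n)) - b) * norm x"
  proof -
    have "sqrt_iter_bound (Suc (Suc n)) = (1 + b\<^sup>2) / 2" "b = (1 + a\<^sup>2) / 2"
      by (simp_all add: a_def b_def)
    then have eq: "sqrt_iter_bound (Suc (Suc n)) - b = (b\<^sup>2 - a\<^sup>2) / 2"
      by (simp only: diff_divide_distrib add_divide_distrib)
    show ?thesis
      unfolding eq by (simp add: power2_eq_square algebra_simps)
  qed
  finally show ?case
    unfolding Z_def b_def .
qed

lemma convergent_sqrt_iter:
  fixes B :: "'a::{real_normed_vector, complete_space} \<Rightarrow> 'a"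
  assumes lin: "linear B" and contr: "\<And>x. norm (B x) \<le> norm x"
  shows "convergent (\<lambda>n. sqrt_iter B n x)"
proof -
  have diff: "norm (sqrt_iter B (n + k) x - sqrt_iter B n x)
      \<le> (sqrt_iter_bound (n + k) - sqrt_iter_bound n) * norm x" for n k
  proof (induction k)
    case (Suc k)
    have "norm (sqrt_iter B (Suc (n + k)) x - sqrt_iter B n x)
        \<le> norm (sqrt_iter B (Suc (n + k)) x - sqrt_iter B (n + k) x)
          + norm (sqrt_iter B (n + k) x - sqrt_iter B n x)"
      using norm_triangle_ineq[of "sqrt_iter B (Suc (n + k)) x - sqrt_iter B (n + k) x"
          "sqrt_iter B (n + k) x - sqrt_iter B n x"] by (simp del: sqrt_iter.simps)
    also have "\<dots> \<le> (sqrt_iter_bound (Suc (n + k)) - sqrt_iter_bound (n + k)) * norm x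
          + (sqrt_iter_bound (n + k) - sqrt_iter_bound n) * norm x"
      by (rule add_mono[OF norm_sqrt_iter_step[OF lin contr] Suc])
    finally show ?case
      by (simp only: add_Suc_right) (simp only: left_diff_distrib)
  qed simp
  have "convergent sqrt_iter_bound"
    using incseq_convergent[OF incseq_sqrt_iter_bound, of 1] sqrt_iter_bound_range
    unfolding convergent_def by blast
  then have "Cauchy (\<lambda>n. sqrt_iter_bound n * norm x)"
    by (intro convergent_Cauchy) (auto simp: convergent_def intro: tendsto_mult_right)
  have "Cauchy (\<lambda>n. sqrt_iter B n x)"
  proof (rule CauchyI')
    fix e :: real assume "e > 0"
    then obtain N where N: "\<And>m n. m \<ge> N \<Longrightarrow> n \<ge> N \<Longrightarrow>
        \<bar>sqrt_iter_bound m * norm x - sqrt_iter_bound n * norm x\<bar> < e"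
      using CauchyD[OF \<open>Cauchy (\<lambda>n. sqrt_iter_bound n * norm x)\<close>, of e]
      unfolding real_norm_def by blast
    have "dist (sqrt_iter B m x) (sqrt_iter B n x) < e" if "m \<ge> N" "m < n" for m n
    proof -
      have "norm (sqrt_iter B n x - sqrt_iter B m x) \<le> (sqrt_iter_bound n - sqrt_iter_bound m) * norm x"
        using diff[of m "n - m"] that by simp
      also have "\<dots> < e"
        using N[of n m] that by (simp add: left_diff_distrib)
      finally show ?thesis
        by (simp add: dist_norm norm_minus_commute)
    qed
    then show "\<exists>M. \<forall>m\<ge>M. \<forall>n>m. dist (sqrt_iter B m x) (sqrt_iter B n x) < e"
      by blast
  qed
  then show ?thesis
    by (rule Cauchy_convergent)
qed

lemma sqrt_iter_limit:
  fixes B :: "'a::{real_normed_vector, complete_space} \<Rightarrow> 'a"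
  assumes B: "bounded_linear B" and contr: "\<And>x. norm (B x) \<le> norm x"
  obtains Y where "\<And>x. (\<lambda>n. sqrt_iter B n x) \<longlonglongrightarrow> Y x" "\<And>x y. Y (x + y) = Y x + Y y"
    "\<And>x. norm (Y x) \<le> norm x" "\<And>x. Y x = (1/2) *\<^sub>R (B x + Y (Y x))"
    "\<forall>C. bounded_linear C \<longrightarrow> (\<forall>x. C (B x) = B (C x)) \<longrightarrow> (\<forall>x. C (Y x) = Y (C x))"
proof -
  have lin: "linear B"
    using B by (rule bounded_linear.linear)
  obtain Y where Y: "\<And>x. (\<lambda>n. sqrt_iter B n x) \<longlonglongrightarrow> Y x"
    using convergent_sqrt_iter[OF lin contr] unfolding convergent_def by metis
  have norm_le: "norm (sqrt_iter B n x) \<le> norm x" for n x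
    using norm_sqrt_iter_le[OF contr, of n x] sqrt_iter_bound_range[of n]
    by (meson mult_left_le_one_le norm_ge_zero order_trans)
  have add: "Y (x + y) = Y x + Y y" for x y
  proof (rule LIMSEQ_unique[OF Y])
    show "(\<lambda>n. sqrt_iter B n (x + y)) \<longlonglongrightarrow> Y x + Y y"
      using tendsto_add[OF Y[of x] Y[of y]] by (simp add: linear_add[OF linear_sqrt_iter[OF lin]])
  qed
  have contrY: "norm (Y x) \<le> norm x" for x
    by (rule LIMSEQ_le_const2[OF tendsto_norm[OF Y]]) (use norm_le in auto)
  have sq: "(\<lambda>n. sqrt_iter B n (sqrt_iter B n x)) \<longlonglongrightarrow> Y (Y x)" for x
  proof -
    have "(\<lambda>n. sqrt_iter B n (sqrt_iter B n x - Y x)) \<longlonglongrightarrow> 0"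
    proof (rule Lim_null_comparison)
      show "\<forall>\<^sub>F n in sequentially. norm (sqrt_iter B n (sqrt_iter B n x - Y x)) \<le> norm (sqrt_iter B n x - Y x)"
        using norm_le by simp
      show "(\<lambda>n. norm (sqrt_iter B n x - Y x)) \<longlonglongrightarrow> 0"
        using Y[of x] by (simp add: LIM_zero tendsto_norm_zero)
    qed
    from tendsto_add[OF this Y[of "Y x"]] show ?thesis
      by (simp add: linear_diff[OF linear_sqrt_iter[OF lin]])
  qed
  have fix_eq: "Y x = (1/2) *\<^sub>R (B x + Y (Y x))" for x
  proof (rule LIMSEQ_unique[OF LIMSEQ_Suc[OF Y]])
    show "(\<lambda>n. sqrt_iter B (Suc n) x) \<longlonglongrightarrow> (1/2) *\<^sub>R (B x + Y (Y x))"
      using tendsto_scaleR[OF tendsto_const tendsto_add[OF tendsto_const sq], of "1/2" "B x" x] by simp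
  qed
  have comm: "C (Y x) = Y (C x)" if C: "bounded_linear C" and CB: "\<And>x. C (B x) = B (C x)" for C x
  proof (rule LIMSEQ_unique)
    show "(\<lambda>n. C (sqrt_iter B n x)) \<longlonglongrightarrow> C (Y x)"
      by (rule bounded_linear.tendsto[OF C Y])
    show "(\<lambda>n. C (sqrt_iter B n x)) \<longlonglongrightarrow> Y (C x)"
      using Y[of "C x"] by (simp add: sqrt_iter_commute[where C = C and B = B, OF bounded_linear.linear[OF C] CB])
  qed
  show thesis
    by (rule that[OF Y add contrY fix_eq]) (simp add: comm)
qed

lemma sqrt_iter_symmetric:
  fixes B :: "'a::complex_inner \<Rightarrow> 'a"
  assumes "\<And>x y. cinner (B x) y = cinner x (B y)"
  shows "cinner (sqrt_iter B n x) y = cinner x (sqrt_iter B n y)"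
  by (induction n arbitrary: x y)
     (simp_all add: cinner_scaleR_left cinner_scaleR_right cinner_add_left cinner_add_right assms)

lemma bounded_linear_scaleC: "bounded_linear (\<lambda>x::'a::complex_inner. c *\<^sub>C x)"
  by (rule bounded_linear_intro[where K = "cmod c"])
     (simp_all add: scaleC_add_right scaleR_scaleC scaleC_scaleC norm_scaleC mult.commute)

text \<open>Division by a bound \<open>K\<close> of \<open>T\<close> makes \<open>1 - T\<^sup>* T / K\<^sup>2\<close> a contraction, because the norm of
  \<open>T\<^sup>* T x\<close> is at most \<open>K * norm (T x)\<close>.\<close>

lemma positive_square_root_exists:
  assumes T: "bounded_clinear T"
  obtains P where "positive_op P" "\<And>x. P (P x) = cadjoint T (T x)"
    "\<forall>C. bounded_linear C \<longrightarrow> (\<forall>x. C (cadjoint T (T x)) = cadjoint T (T (C x)))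
      \<longrightarrow> (\<forall>x. C (P x) = P (C x))"
proof -
  obtain K where K: "K > 0" "\<And>x. norm (T x) \<le> K * norm x"
    using bounded_clinear_bound[OF T] by blast
  define A where "A x = cadjoint T (T x)" for x
  define B where "B x = x - (1 / K\<^sup>2) *\<^sub>R A x" for x
  note T' = bounded_clinear_cadjoint[OF T]
  have A_sym: "cinner (A x) y = cinner x (A y)" for x y
    by (simp add: A_def cinner_cadjoint[OF T] cinner_cadjoint_left[OF T])
  have A_scale: "A (c *\<^sub>C x) = c *\<^sub>C A x" for c x
    by (simp add: A_def bounded_clinear_scaleC[OF T] bounded_clinear_scaleC[OF T'])
  have A_lin: "bounded_linear A"
    using bounded_linear_compose[of "cadjoint T" T] T T' unfolding A_def bounded_clinear_def by simp
  have B_lin: "bounded_linear B"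
    unfolding B_def
    by (intro bounded_linear_sub bounded_linear_ident bounded_linear_compose[OF bounded_linear_scaleR_right A_lin])
  have B_sym: "cinner (B x) y = cinner x (B y)" for x y
    by (simp add: B_def cinner_diff_left cinner_diff_right cinner_scaleR_left cinner_scaleR_right A_sym)
  have B_contr: "norm (B x) \<le> norm x" for x
  proof -
    have "norm (A x) \<le> K * norm (T x)"
      unfolding A_def by (rule norm_cadjoint_le[OF T K(2)])
    then have "(norm (A x))\<^sup>2 \<le> K\<^sup>2 * (norm (T x))\<^sup>2"
      by (metis norm_ge_zero power_mono power_mult_distrib)
    then have "(norm (A x))\<^sup>2 / K^4 \<le> (norm (T x))\<^sup>2 / K\<^sup>2"
      using K(1) by (simp add: field_simps power4_eq_xxxx power2_eq_square)
    moreover have "Re (cinner x (A x)) = (norm (T x))\<^sup>2"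
      by (simp add: A_def cinner_cadjoint[OF T, symmetric] cinner_self)
    then have "(norm (B x))\<^sup>2 = (norm x)\<^sup>2 + (norm (A x))\<^sup>2 / K^4 - 2 * ((norm (T x))\<^sup>2 / K\<^sup>2)"
      unfolding B_def norm_diff_square
      by (simp add: cinner_scaleR_right power_divide power4_eq_xxxx power2_eq_square)
    moreover have "0 \<le> (norm (T x))\<^sup>2 / K\<^sup>2"
      by simp
    ultimately have "(norm (B x))\<^sup>2 \<le> (norm x)\<^sup>2"
      by linarith
    then show ?thesis
      by (rule power2_le_imp_le) simp
  qed
  obtain Y where Y: "\<And>x. (\<lambda>n. sqrt_iter B n x) \<longlonglongrightarrow> Y x" "\<And>x y. Y (x + y) = Y x + Y y"
    "\<And>x. norm (Y x) \<le> norm x" "\<And>x. Y x = (1/2) *\<^sub>R (B x + Y (Y x))"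
    and comm_all: "\<forall>C. bounded_linear C \<longrightarrow> (\<forall>x. C (B x) = B (C x)) \<longrightarrow> (\<forall>x. C (Y x) = Y (C x))"
    by (rule sqrt_iter_limit[OF B_lin B_contr]) (rule that)
  have comm: "C (Y x) = Y (C x)" if "bounded_linear C" "\<And>x. C (B x) = B (C x)" for C x
    using comm_all that by simp
  have Y_scale: "Y (c *\<^sub>C x) = c *\<^sub>C Y x" for c x
    by (rule comm[symmetric, OF bounded_linear_scaleC])
       (simp add: B_def A_scale linear_diff[OF bounded_linear.linear[OF bounded_linear_scaleC]]
         scaleR_scaleC scaleC_scaleC mult.commute)
  have Y_sym: "cinner (Y x) y = cinner x (Y y)" for x y
  proof (rule LIMSEQ_unique)
    show "(\<lambda>n. cinner (sqrt_iter B n x) y) \<longlonglongrightarrow> cinner (Y x) y"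
      by (rule tendsto_cinner[OF Y(1) tendsto_const])
    show "(\<lambda>n. cinner (sqrt_iter B n x) y) \<longlonglongrightarrow> cinner x (Y y)"
      unfolding sqrt_iter_symmetric[OF B_sym] by (rule tendsto_cinner[OF tendsto_const Y(1)])
  qed
  define P where "P x = K *\<^sub>R (x - Y x)" for x
  have Y_diff: "Y (x - y) = Y x - Y y" for x y
    using Y(2)[of "x - y" y] by (simp add: algebra_simps)
  have Y_scaleR: "Y (r *\<^sub>R x) = r *\<^sub>R Y x" for r x
    by (simp add: scaleR_scaleC Y_scale)
  show thesis
  proof (rule that)
    show "positive_op P"
    proof (rule positive_opI)
      show "bounded_clinear P"
      proof (rule bounded_clinearI)
        show "norm (P x) \<le> norm x * (2 * K)" for x
          using K(1) norm_triangle_ineq4[of x "Y x"] Y(3)[of x] by (simp add: P_def)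
        show "P (c *\<^sub>C x) = c *\<^sub>C P x" for c x
          by (simp add: P_def Y_scale scaleR_scaleC scaleC_scaleC mult.commute
              linear_diff[OF bounded_linear.linear[OF bounded_linear_scaleC]])
      qed (simp add: P_def Y(2) algebra_simps)
      show "cinner (P x) y = cinner x (P y)" for x y
        by (simp add: P_def cinner_diff_left cinner_diff_right cinner_scaleR_left cinner_scaleR_right Y_sym)
      show "0 \<le> Re (cinner (P x) x)" for x
      proof -
        have "Re (cinner (Y x) x) \<le> norm (Y x) * norm x"
          using cinner_Cauchy_Schwarz complex_Re_le_cmod order_trans by blast
        also have "\<dots> \<le> (norm x)\<^sup>2"
          using Y(3)[of x] by (simp add: power2_eq_square mult_right_mono)
        finally show ?thesis
          using K(1) by (simp add: P_def cinner_scaleR_left cinner_diff_left cinner_self)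
      qed
    qed
    show "P (P x) = cadjoint T (T x)" for x
    proof -
      have "2 *\<^sub>R Y x = B x + Y (Y x)"
        by (subst Y(4)) simp
      then have "x - Y x - (Y x - Y (Y x)) = (1 / K\<^sup>2) *\<^sub>R A x"
        by (simp add: B_def algebra_simps scaleR_2)
      moreover have "P (P x) = (K * K) *\<^sub>R (x - Y x - (Y x - Y (Y x)))"
        by (simp add: P_def Y_diff Y_scaleR flip: scaleR_diff_right)
      ultimately show ?thesis
        using K(1) by (simp add: power2_eq_square A_def)
    qed
    have "C (P x) = P (C x)"
      if C: "bounded_linear C" and CA: "\<And>x. C (cadjoint T (T x)) = cadjoint T (T (C x))" for C x
    proof -
      have "C (Y x) = Y (C x)"
        by (rule comm[OF C]) (simp add: B_def A_def CA linear_simps[OF C])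
      then show ?thesis
        by (simp add: P_def linear_simps[OF C])
    qed
    then show "\<forall>C. bounded_linear C \<longrightarrow> (\<forall>x. C (cadjoint T (T x)) = cadjoint T (T (C x)))
      \<longrightarrow> (\<forall>x. C (P x) = P (C x))"
      by simp
  qed
qed

text \<open>Let \<open>P\<close> be the root constructed above. Another root \<open>Q\<close> commutes with its square, hence with
  \<open>P\<close>. Then \<open>(P + Q) (P - Q) = 0\<close>, so on \<open>y = (P - Q) x\<close> the forms of \<open>P\<close> and \<open>Q\<close> add up to \<open>0\<close>, both
  operators kill \<open>y\<close>, and \<open>(norm y)\<^sup>2 = cinner x ((P - Q) y) = 0\<close>.\<close>

lemma
  assumes T: "bounded_clinear T"
  shows positive_op_abs_op: "positive_op (abs_op T)"
    and abs_op_abs_op: "abs_op T (abs_op T x) = cadjoint T (T x)"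
    and abs_op_commute: "bounded_linear C \<Longrightarrow> (\<And>x. C (cadjoint T (T x)) = cadjoint T (T (C x)))
      \<Longrightarrow> C (abs_op T x) = abs_op T (C x)"
    and abs_op_eqI: "positive_op Q \<Longrightarrow> (\<And>x. Q (Q x) = cadjoint T (T x)) \<Longrightarrow> abs_op T = Q"
proof -
  obtain P where P: "positive_op P" "\<And>x. P (P x) = cadjoint T (T x)"
    and comm_all: "\<forall>C. bounded_linear C \<longrightarrow> (\<forall>x. C (cadjoint T (T x)) = cadjoint T (T (C x)))
      \<longrightarrow> (\<forall>x. C (P x) = P (C x))"
    by (rule positive_square_root_exists[OF T]) (rule that)
  have comm: "C (P x) = P (C x)"
    if "bounded_linear C" "\<And>x. C (cadjoint T (T x)) = cadjoint T (T (C x))" for C x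
    using comm_all that by simp
  have unique: "Q = P" if Q: "positive_op Q" "\<And>x. Q (Q x) = cadjoint T (T x)" for Q
  proof
    fix x
    note linP = bounded_clinear_diff[OF positive_op_bounded_clinear[OF P(1)]]
    note linQ = bounded_clinear_diff[OF positive_op_bounded_clinear[OF Q(1)]]
    have QP: "Q (P x) = P (Q x)" for x
      by (rule comm)
         (use positive_op_bounded_clinear[OF Q(1)] in \<open>simp_all add: bounded_clinear_def flip: Q(2)\<close>)
    define y where "y = P x - Q x"
    have "P y + Q y = 0"
      by (simp add: y_def linP linQ P(2) Q(2) QP)
    then have "Re (cinner (P y) y) + Re (cinner (Q y) y) = 0"
      by (metis cinner_add_left cinner_zero_left plus_complex.sel(1) zero_complex.sel(1))
    then have "Re (cinner (P y) y) \<le> 0" "Re (cinner (Q y) y) \<le> 0"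
      using positive_op_nonneg[OF P(1), of y] positive_op_nonneg[OF Q(1), of y] by linarith+
    then have "P y = 0" "Q y = 0"
      using positive_op_form_zero[OF P(1)] positive_op_form_zero[OF Q(1)] by simp_all
    moreover have "cinner y y = cinner x (P y) - cinner x (Q y)"
      by (simp add: y_def cinner_diff_left positive_op_cinner[OF P(1)] positive_op_cinner[OF Q(1)])
    ultimately have "y = 0"
      by (simp add: cinner_eq_zero_iff)
    then show "Q x = P x"
      by (simp add: y_def)
  qed
  have abs: "abs_op T = P"
    unfolding abs_op_def sqrt_op_def
  proof (rule the_equality)
    show "positive_op P \<and> P \<circ> P = cadjoint T \<circ> T"
      by (simp add: P fun_eq_iff)
    show "B = P" if "positive_op B \<and> B \<circ> B = cadjoint T \<circ> T" for B
      by (rule unique) (use that in \<open>simp_all add: fun_eq_iff\<close>)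
  qed
  show "positive_op (abs_op T)" "abs_op T (abs_op T x) = cadjoint T (T x)"
    by (simp_all add: abs P)
  show "C (abs_op T x) = abs_op T (C x)"
    if "bounded_linear C" "\<And>x. C (cadjoint T (T x)) = cadjoint T (T (C x))"
    using comm[OF that] by (simp add: abs)
  show "abs_op T = Q" if "positive_op Q" "\<And>x. Q (Q x) = cadjoint T (T x)"
    using unique[OF that] by (simp add: abs)
qed

lemma norm_abs_op:
  assumes T: "bounded_clinear T"
  shows "norm (abs_op T x) = norm (T x)"
proof -
  have "cinner (abs_op T x) (abs_op T x) = cinner (T x) (T x)"
    by (simp add: positive_op_cinner[OF positive_op_abs_op[OF T]] abs_op_abs_op[OF T] cinner_cadjoint[OF T])
  then show ?thesis
    by (simp add: norm_eq_sqrt_cinner)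
qed

lemma abs_op_eq_zero_iff: "bounded_clinear T \<Longrightarrow> abs_op T x = 0 \<longleftrightarrow> T x = 0"
  using norm_abs_op[of T x] by (metis norm_eq_zero)

section \<open>Partial isometries and the polar decomposition\<close>

lemma kernel_orthogonal_decomposition:
  fixes V :: "'a::complex_hilbert \<Rightarrow> 'a"
  assumes V: "bounded_clinear V"
  obtains k u where "x = k + u" "V k = 0" "\<And>z. V z = 0 \<Longrightarrow> cinner u z = 0"
proof -
  obtain s p where s: "\<And>n::nat. V (s n) = 0" "s \<longlonglongrightarrow> p"
    and orth: "\<And>z. V z = 0 \<Longrightarrow> cinner (x - p) z = 0"
    by (rule orthogonal_projection_exists[of "{z. V z = 0}" x])
       (auto simp: bounded_clinear_zero[OF V] bounded_clinear_add[OF V] bounded_clinear_scaleC[OF V])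
  have "V p = 0"
    using bounded_clinear_tendsto[OF V s(2)] s(1) by (simp add: LIMSEQ_const_iff)
  then show thesis
    using orth by (intro that[of p "x - p"]) auto
qed

lemma partial_isometry_bounded_clinear: "partial_isometry V \<Longrightarrow> bounded_clinear V"
  unfolding partial_isometry_def by simp

lemma partial_isometry_norm:
  "partial_isometry V \<Longrightarrow> (\<And>z. V z = 0 \<Longrightarrow> cinner u z = 0) \<Longrightarrow> norm (V u) = norm u"
  unfolding partial_isometry_def ker_op_def by simp

lemma partial_isometry_norm_le:
  assumes V: "partial_isometry V"
  shows "norm (V x) \<le> norm x"
proof -
  note V' = partial_isometry_bounded_clinear[OF V]
  obtain k u where x: "x = k + u" "V k = 0" and u: "\<And>z. V z = 0 \<Longrightarrow> cinner u z = 0"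
    using kernel_orthogonal_decomposition[OF V'] by blast
  have "cinner k u = 0"
    using u[OF x(2)] cinner_commute[of k u] by simp
  then have "(norm x)\<^sup>2 = (norm k)\<^sup>2 + (norm u)\<^sup>2"
    using norm_diff_square[of k "- u"] x(1) by (simp add: cinner_minus_right)
  then have "norm u \<le> norm x"
    by (intro power2_le_imp_le[of "norm u" "norm x"]) simp_all
  moreover have "norm (V x) = norm u"
    using x partial_isometry_norm[OF V u] by (simp add: bounded_clinear_add[OF V'])
  ultimately show ?thesis
    by simp
qed

text \<open>Expanding \<open>(norm (V\<^sup>* V u - u))\<^sup>2\<close> gives at most \<open>(norm u)\<^sup>2 - (norm (V u))\<^sup>2\<close>, as \<open>V\<^sup>*\<close> is a contraction.\<close>

lemma partial_isometry_cadjoint_self: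
  assumes V: "partial_isometry V" and u: "\<And>z. V z = 0 \<Longrightarrow> cinner u z = 0"
  shows "cadjoint V (V u) = u"
proof -
  note V' = partial_isometry_bounded_clinear[OF V]
  have "norm (cadjoint V (V u)) \<le> norm u"
    using norm_cadjoint_le[OF V', of 1 "V u"] partial_isometry_norm_le[OF V] partial_isometry_norm[OF V u]
    by simp
  then have "(norm (cadjoint V (V u)))\<^sup>2 \<le> (norm u)\<^sup>2"
    by simp
  moreover have "Re (cinner (cadjoint V (V u)) u) = (norm u)\<^sup>2"
    by (simp add: cinner_cadjoint_left[OF V'] cinner_self partial_isometry_norm[OF V u])
  ultimately have "(norm (cadjoint V (V u) - u))\<^sup>2 \<le> 0"
    unfolding norm_diff_square by simp
  then show ?thesis
    by simp
qed

lemma partial_isometry_cube: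
  assumes V: "partial_isometry V"
  shows "V (cadjoint V (V x)) = V x"
proof -
  note V' = partial_isometry_bounded_clinear[OF V]
  obtain k u where x: "x = k + u" "V k = 0" and u: "\<And>z. V z = 0 \<Longrightarrow> cinner u z = 0"
    using kernel_orthogonal_decomposition[OF V'] by blast
  have "V x = V u"
    by (simp add: x bounded_clinear_add[OF V'])
  then show ?thesis
    using partial_isometry_cadjoint_self[OF V u] by simp
qed

text \<open>The polar isometry of \<open>T\<close> as a relation between \<open>x\<close> and \<open>v\<close>, with the projection \<open>p\<close> of \<open>x\<close> onto
  the closure of the range of \<open>abs_op T\<close> recorded in between: it sends a limit of vectors \<open>abs_op T (y n)\<close> to the limit of
  \<open>T (y n)\<close> and annihilates the vectors orthogonal to the range of \<open>abs_op T\<close>.\<close>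

definition polar_graph :: "('a::complex_hilbert \<Rightarrow> 'a) \<Rightarrow> 'a \<Rightarrow> 'a \<Rightarrow> 'a \<Rightarrow> bool" where
  "polar_graph T x p v \<longleftrightarrow>
     (\<exists>y::nat \<Rightarrow> 'a. (\<lambda>n. abs_op T (y n)) \<longlonglongrightarrow> p \<and> (\<lambda>n. T (y n)) \<longlonglongrightarrow> v)
     \<and> (\<forall>z. cinner (x - p) (abs_op T z) = 0)"

lemma polar_graphI:
  assumes "(\<lambda>n. abs_op T (y n)) \<longlonglongrightarrow> p" "(\<lambda>n. T (y n)) \<longlonglongrightarrow> v"
    and "\<And>z. cinner (x - p) (abs_op T z) = 0"
  shows "polar_graph T x p v"
  using assms unfolding polar_graph_def by (auto intro: exI[of _ y])

context
  fixes T :: "'a::complex_hilbert \<Rightarrow> 'a"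
  assumes T: "bounded_clinear T"
begin

lemma bounded_clinear_abs_op: "bounded_clinear (abs_op T)"
  using positive_op_abs_op[OF T] by (rule positive_op_bounded_clinear)

lemma cinner_abs_op: "cinner (abs_op T x) y = cinner x (abs_op T y)"
  using positive_op_abs_op[OF T] by (rule positive_op_cinner)

lemma orthogonal_range_abs_op_iff: "(\<forall>z. cinner u (abs_op T z) = 0) \<longleftrightarrow> T u = 0"
proof -
  have "(\<forall>z. cinner u (abs_op T z) = 0) \<longleftrightarrow> abs_op T u = 0"
    using cinner_extensionality[of "abs_op T u" 0] by (auto simp: cinner_abs_op[symmetric])
  then show ?thesis
    by (simp add: abs_op_eq_zero_iff[OF T])
qed

lemma polar_graph_exists: "\<exists>p v. polar_graph T x p v"
proof -
  have zero: "0 \<in> range (abs_op T)"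
    by (rule range_eqI[of _ _ 0]) (simp add: bounded_clinear_zero[OF bounded_clinear_abs_op])
  have add: "a + b \<in> range (abs_op T)" if "a \<in> range (abs_op T)" "b \<in> range (abs_op T)" for a b
    using that by (auto simp flip: bounded_clinear_add[OF bounded_clinear_abs_op])
  have scale: "c *\<^sub>C a \<in> range (abs_op T)" if "a \<in> range (abs_op T)" for c a
    using that by (auto simp flip: bounded_clinear_scaleC[OF bounded_clinear_abs_op])
  obtain s p where s: "\<And>n::nat. s n \<in> range (abs_op T)" "s \<longlonglongrightarrow> p"
    and orth: "\<And>z. z \<in> range (abs_op T) \<Longrightarrow> cinner (x - p) z = 0"
    using orthogonal_projection_exists[of "range (abs_op T)" x, OF zero add scale] by blast
  have "\<forall>n. \<exists>y. s n = abs_op T y"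
    using s(1) by (simp add: image_iff)
  then obtain y where y: "\<And>n. s n = abs_op T (y n)"
    by (rule choice[THEN exE]) blast
  \<comment> \<open>Since \<open>T\<close> and \<open>abs_op T\<close> have the same norms, \<open>T (y n)\<close> is Cauchy as well.\<close>
  have "dist (T (y m)) (T (y n)) = dist (s m) (s n)" for m n
    using norm_abs_op[OF T, of "y m - y n"]
    by (simp add: dist_norm y bounded_clinear_diff[OF T] bounded_clinear_diff[OF bounded_clinear_abs_op])
  then have "Cauchy (\<lambda>n. T (y n))"
    using LIMSEQ_imp_Cauchy[OF s(2)] unfolding Cauchy_def by simp
  then obtain v where "(\<lambda>n. T (y n)) \<longlonglongrightarrow> v"
    using Cauchy_convergent convergent_def by blast
  moreover have "(\<lambda>n. abs_op T (y n)) \<longlonglongrightarrow> p"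
    using s(2) by (simp flip: y)
  ultimately have "polar_graph T x p v"
    using orth by (intro polar_graphI[where y = y]) auto
  then show ?thesis by blast
qed

lemma polar_graph_norm:
  assumes "polar_graph T x p v" shows "norm v = norm p"
proof -
  obtain y :: "nat \<Rightarrow> 'a" where y: "(\<lambda>n. abs_op T (y n)) \<longlonglongrightarrow> p" "(\<lambda>n. T (y n)) \<longlonglongrightarrow> v"
    using assms unfolding polar_graph_def by blast
  have "(\<lambda>n. norm (T (y n))) \<longlonglongrightarrow> norm p"
    using tendsto_norm[OF y(1)] by (simp add: norm_abs_op[OF T])
  with tendsto_norm[OF y(2)] show ?thesis
    by (rule LIMSEQ_unique)
qed

lemma polar_graph_orthogonal:
  assumes "polar_graph T x p v" shows "cinner p (x - p) = 0"
proof -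
  obtain y :: "nat \<Rightarrow> 'a" where y: "(\<lambda>n. abs_op T (y n)) \<longlonglongrightarrow> p" and orth: "\<And>z. cinner (x - p) (abs_op T z) = 0"
    using assms unfolding polar_graph_def by blast
  have "(\<lambda>n. cinner (x - p) (abs_op T (y n))) \<longlonglongrightarrow> cinner (x - p) p"
    by (rule tendsto_cinner[OF tendsto_const y])
  then have "cinner (x - p) p = 0"
    by (simp add: orth LIMSEQ_const_iff)
  then show ?thesis
    using cinner_commute[of p "x - p"] by simp
qed

lemma polar_graph_norm_le:
  assumes "polar_graph T x p v" shows "norm v \<le> norm x"
proof -
  have "(norm x)\<^sup>2 = (norm p)\<^sup>2 + (norm (x - p))\<^sup>2"
    using norm_diff_square[of p "- (x - p)"] polar_graph_orthogonal[OF assms]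
    by (simp add: cinner_diff_right norm_minus_commute)
  then show ?thesis
    unfolding polar_graph_norm[OF assms] by (intro power2_le_imp_le[of "norm p" "norm x"]) simp_all
qed

lemma polar_graph_add:
  assumes "polar_graph T x p v" "polar_graph T x' p' v'"
  shows "polar_graph T (x + x') (p + p') (v + v')"
proof -
  obtain y y' :: "nat \<Rightarrow> 'a" where
    "(\<lambda>n. abs_op T (y n)) \<longlonglongrightarrow> p" "(\<lambda>n. T (y n)) \<longlonglongrightarrow> v"
    "(\<lambda>n. abs_op T (y' n)) \<longlonglongrightarrow> p'" "(\<lambda>n. T (y' n)) \<longlonglongrightarrow> v'"
    using assms unfolding polar_graph_def by blast
  then have "(\<lambda>n. abs_op T (y n + y' n)) \<longlonglongrightarrow> p + p'" "(\<lambda>n. T (y n + y' n)) \<longlonglongrightarrow> v + v'"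
    by (simp_all add: bounded_clinear_add[OF T] bounded_clinear_add[OF bounded_clinear_abs_op] tendsto_add)
  moreover have "cinner (x + x' - (p + p')) (abs_op T z) = 0" for z
    using assms by (simp add: polar_graph_def add_diff_add cinner_add_left)
  ultimately show ?thesis
    by (rule polar_graphI)
qed

lemma polar_graph_scaleC:
  assumes "polar_graph T x p v"
  shows "polar_graph T (c *\<^sub>C x) (c *\<^sub>C p) (c *\<^sub>C v)"
proof -
  obtain y :: "nat \<Rightarrow> 'a" where "(\<lambda>n. abs_op T (y n)) \<longlonglongrightarrow> p" "(\<lambda>n. T (y n)) \<longlonglongrightarrow> v"
    using assms unfolding polar_graph_def by blast
  then have "(\<lambda>n. abs_op T (c *\<^sub>C y n)) \<longlonglongrightarrow> c *\<^sub>C p" "(\<lambda>n. T (c *\<^sub>C y n)) \<longlonglongrightarrow> c *\<^sub>C v"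
    by (simp_all add: bounded_clinear_scaleC[OF T] bounded_clinear_scaleC[OF bounded_clinear_abs_op]
        bounded_linear.tendsto[OF bounded_linear_scaleC])
  moreover have "cinner (c *\<^sub>C x - c *\<^sub>C p) (abs_op T z) = 0" for z
    using assms by (simp add: polar_graph_def cinner_scaleC_left cinner_diff_left)
  ultimately show ?thesis
    by (rule polar_graphI)
qed

lemma polar_graph_unique:
  assumes "polar_graph T x p v" "polar_graph T x p' v'"
  shows "v = v'"
proof -
  have neg: "(-1) *\<^sub>C w = - w" for w :: 'a
    using scaleR_scaleC[of "-1" w] by simp
  have "polar_graph T (x + (-1) *\<^sub>C x) (p + (-1) *\<^sub>C p') (v + (-1) *\<^sub>C v')"
    by (rule polar_graph_add[OF assms(1) polar_graph_scaleC[OF assms(2)]])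
  then have "norm (v - v') \<le> norm (0::'a)"
    unfolding neg by (auto dest: polar_graph_norm_le)
  then show ?thesis by simp
qed

text \<open>The norm equality of \<open>T\<close> and \<open>abs_op T\<close> makes \<open>polar_graph\<close> the graph of a contraction, which is a
  partial isometry with the required properties. Conversely these properties determine a partial
  isometry on the range of \<open>abs_op T\<close>, by continuity on its closure, and on the orthogonal complement,
  which is the kernel of \<open>T\<close>.\<close>

lemma
  shows partial_isometry_polar: "partial_isometry (polar_isometry T)"
    and polar_decomposition: "polar_isometry T (abs_op T x) = T x"
    and polar_isometry_eq_zero_iff: "polar_isometry T x = 0 \<longleftrightarrow> T x = 0"
proof -
  obtain p V where V: "\<And>x. polar_graph T x (p x) (V x)"
    using polar_graph_exists by metis
  have V_eq: "V x = v" if "polar_graph T x q v" for x q v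
    using polar_graph_unique[OF V that] .
  have range: "V (abs_op T y) = T y" for y
    by (rule V_eq[of _ "abs_op T y"], rule polar_graphI[where y = "\<lambda>n. y"]) simp_all
  have ker: "V x = 0 \<longleftrightarrow> T x = 0" for x
  proof
    assume "V x = 0"
    then have "p x = 0"
      using polar_graph_norm[OF V[of x]] by simp
    then show "T x = 0"
      using V[of x] orthogonal_range_abs_op_iff[of x] by (simp add: polar_graph_def)
  next
    assume "T x = 0"
    then have "polar_graph T x 0 0"
      using orthogonal_range_abs_op_iff[of x]
      by (intro polar_graphI[where y = "\<lambda>n. 0"])
         (simp_all add: bounded_clinear_zero[OF T] bounded_clinear_zero[OF bounded_clinear_abs_op])
    then show "V x = 0" by (rule V_eq)
  qed
  have bcl: "bounded_clinear V"
  proof (rule bounded_clinearI)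
    show "V (x + y) = V x + V y" for x y
      by (rule V_eq[OF polar_graph_add[OF V V]])
    show "V (c *\<^sub>C x) = c *\<^sub>C V x" for c x
      by (rule V_eq[OF polar_graph_scaleC[OF V]])
    show "norm (V x) \<le> norm x * 1" for x
      using polar_graph_norm_le[OF V] by simp
  qed
  have "norm (V x) = norm x" if orth: "\<And>z. V z = 0 \<Longrightarrow> cinner x z = 0" for x
  proof -
    have "T (x - p x) = 0"
      using V[of x] orthogonal_range_abs_op_iff[of "x - p x"] by (simp add: polar_graph_def)
    then have "cinner x (x - p x) = 0"
      using orth ker by simp
    then have "cinner (x - p x) (x - p x) = 0"
      using polar_graph_orthogonal[OF V, of x] by (simp add: cinner_diff_left)
    then have "x = p x"
      by (simp add: cinner_eq_zero_iff)
    then show ?thesis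
      using polar_graph_norm[OF V[of x]] by simp
  qed
  then have V_iso: "partial_isometry V"
    unfolding partial_isometry_def ker_op_def using bcl by auto
  have unique: "W = V" if W: "partial_isometry W" "\<And>x. W (abs_op T x) = T x" "\<And>x. W x = 0 \<longleftrightarrow> T x = 0" for W
  proof
    fix x
    note W' = partial_isometry_bounded_clinear[OF W(1)]
    obtain y :: "nat \<Rightarrow> 'a" where y: "(\<lambda>n. abs_op T (y n)) \<longlonglongrightarrow> p x" "(\<lambda>n. T (y n)) \<longlonglongrightarrow> V x"
      and orth: "\<forall>z. cinner (x - p x) (abs_op T z) = 0"
      using V[of x] unfolding polar_graph_def by blast
    have "W (p x) = V x"
      using bounded_clinear_tendsto[OF W' y(1)] y(2) by (simp add: W(2) LIMSEQ_unique)
    moreover have "W (x - p x) = 0"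
      using orth by (simp add: W(3) orthogonal_range_abs_op_iff)
    ultimately show "W x = V x"
      by (simp add: bounded_clinear_diff[OF W'])
  qed
  have polar: "polar_isometry T = V"
    unfolding polar_isometry_def
  proof (rule the_equality)
    show "partial_isometry V \<and> T = V \<circ> abs_op T \<and> ker_op V = ker_op T"
      using V_iso by (simp add: ker_op_def ker range fun_eq_iff)
    show "W = V" if W: "partial_isometry W \<and> T = W \<circ> abs_op T \<and> ker_op W = ker_op T" for W
    proof (rule unique)
      from W have "T = W \<circ> abs_op T" by blast
      from fun_cong[OF this] show "W (abs_op T x) = T x" for x
        unfolding comp_apply by (rule sym)
      from W have "ker_op W = ker_op T" by blast
      then show "W x = 0 \<longleftrightarrow> T x = 0" for x
        by (auto simp: ker_op_def)
    qed (use W in blast)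
  qed
  show "partial_isometry (polar_isometry T)" "polar_isometry T (abs_op T x) = T x"
    "polar_isometry T x = 0 \<longleftrightarrow> T x = 0"
    by (simp_all add: polar V_iso range ker)
qed

end

section \<open>Positivity of the mean transform\<close>

text \<open>For positive \<open>T\<close> one has \<open>abs_op T = T\<close>, and the polar isometry \<open>V\<close> fixes the range
  of \<open>T\<close>. As \<open>V\<^sup>* V\<close> fixes it too, so does \<open>V\<^sup>*\<close>, and taking adjoints in \<open>V\<^sup>* T = T\<close> gives \<open>T V = T\<close>.\<close>

lemma mean_transform_positive_op:
  assumes "positive_op T"
  shows "mean_transform T = T"
proof
  fix x
  note T = positive_op_bounded_clinear[OF assms]
  note V = partial_isometry_polar[OF T]
  note V' = partial_isometry_bounded_clinear[OF V]
  have abs: "abs_op T = T"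
    using assms by (intro abs_op_eqI[OF T]) (simp_all add: positive_op_def)
  have VT: "polar_isometry T (T y) = T y" for y
    using polar_decomposition[OF T] by (simp add: abs)
  have "T (polar_isometry T x) = T x"
  proof (rule cinner_extensionality)
    fix z
    have "cinner (T z) w = 0" if "polar_isometry T w = 0" for w
      using that by (simp add: positive_op_cinner[OF assms] polar_isometry_eq_zero_iff[OF T])
    then have "cadjoint (polar_isometry T) (polar_isometry T (T z)) = T z"
      by (rule partial_isometry_cadjoint_self[OF V])
    then have "cinner (polar_isometry T x) (T z) = cinner x (T z)"
      using cinner_cadjoint[OF V', of x "T z"] by (simp add: VT)
    then show "cinner (T (polar_isometry T x)) z = cinner (T x) z"
      by (simp add: positive_op_cinner[OF assms])
  qed
  then show "mean_transform T x = T x"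
    by (simp add: mean_transform_def abs scaleR_half_eq_scaleC flip: scaleR_2)
qed

text \<open>Write \<open>T = V P\<close> for the polar decomposition. Self-adjointness of \<open>V P + P V\<close> says that \<open>K = V - V\<^sup>*\<close>
  anticommutes with \<open>P\<close>. So \<open>K\<close> commutes with \<open>P\<^sup>2\<close>, hence with \<open>P\<close>, and \<open>K P = P K = 0\<close>.\<close>

lemma polar_isometry_self_adjoint:
  assumes T: "bounded_clinear T"
    and sym: "\<And>x y. cinner (T x + abs_op T (polar_isometry T x)) y
      = cinner x (T y + abs_op T (polar_isometry T y))"
  shows "cadjoint (polar_isometry T) = polar_isometry T"
proof -
  define V P where "V = polar_isometry T" and "P = abs_op T"
  define K where "K x = V x - cadjoint V x" for x
  have V: "partial_isometry V"
    unfolding V_def by (rule partial_isometry_polar[OF T])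
  note V' = partial_isometry_bounded_clinear[OF V]
  have P: "bounded_clinear P"
    unfolding P_def by (rule bounded_clinear_abs_op[OF T])
  have P_sym: "cinner (P x) y = cinner x (P y)" for x y
    unfolding P_def by (rule cinner_abs_op[OF T])
  have T_eq: "T x = V (P x)" for x
    unfolding V_def P_def by (rule polar_decomposition[OF T, symmetric])
  have P_ker: "P x = 0 \<longleftrightarrow> V x = 0" for x
    unfolding V_def P_def by (simp add: polar_isometry_eq_zero_iff[OF T] abs_op_eq_zero_iff[OF T])
  have K_lin: "bounded_linear K"
    using V' bounded_clinear_cadjoint[OF V'] unfolding K_def bounded_clinear_def
    by (intro bounded_linear_sub) auto
  have K_skew: "cinner (K x) y = - cinner x (K y)" for x y
    by (simp add: K_def cinner_diff_left cinner_diff_right cinner_cadjoint[OF V'] cinner_cadjoint_left[OF V'])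
  have anti: "K (P x) = - P (K x)" for x
  proof (rule cinner_extensionality_right)
    fix z
    have "cinner z (V (P x) + P (V x)) = cinner (V (P z) + P (V z)) x"
      using sym[of z x] by (simp add: T_eq V_def P_def)
    also have "\<dots> = cinner z (P (cadjoint V x) + cadjoint V (P x))"
      by (simp add: cinner_add_left cinner_add_right cinner_cadjoint[OF V'] P_sym)
    finally show "cinner z (K (P x)) = cinner z (- P (K x))"
      by (simp add: K_def cinner_add_right cinner_diff_right cinner_minus_right bounded_clinear_diff[OF P]
          algebra_simps)
  qed
  have comm: "K (P x) = P (K x)" for x
    unfolding P_def
  proof (rule abs_op_commute[OF T K_lin])
    show "K (cadjoint T (T x)) = cadjoint T (T (K x))" for x
      unfolding abs_op_abs_op[OF T, symmetric] P_def[symmetric]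
      using anti bounded_clinear_diff[OF P, of 0] bounded_clinear_zero[OF P] by simp
  qed
  have PK: "P (K x) = 0" for x
  proof -
    have "P (K x) + P (K x) = 0"
      using anti[of x] comm[of x] by (metis add.right_inverse)
    then show ?thesis
      by (simp flip: scaleR_2)
  qed
  have "K x = 0" for x
  proof -
    \<comment> \<open>On the complement of \<open>ker V\<close>, test against \<open>K y\<close>, which lies in \<open>ker P = ker V\<close>; on \<open>ker V\<close>, \<open>K\<close>
      is \<open>- V\<^sup>*\<close> and maps into \<open>ker V\<close>, while the range of \<open>V\<^sup>*\<close> is orthogonal to \<open>ker V\<close>.\<close>
    obtain k u where x: "x = k + u" "V k = 0" and u: "\<And>z. V z = 0 \<Longrightarrow> cinner u z = 0"
      using kernel_orthogonal_decomposition[OF V'] by blast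
    have "K u = 0"
      by (rule cinner_extensionality) (simp add: K_skew u PK flip: P_ker)
    have VK: "V (K k) = 0"
      using PK P_ker by blast
    have "cinner (K k) (K k) = - cinner k (V (K k))"
      by (subst (1) K_def) (simp add: x(2) cinner_minus_left cinner_cadjoint_left[OF V'])
    then have "K k = 0"
      by (simp add: VK flip: cinner_eq_zero_iff)
    with \<open>K u = 0\<close> show ?thesis
      by (simp add: x(1) linear_simps[OF K_lin])
  qed
  then show ?thesis
    by (simp add: K_def V_def fun_eq_iff)
qed

text \<open>Here \<open>x = V y - V\<^sup>2 y\<close> is an eigenvector of the self-adjoint partial isometry \<open>V\<close> for the eigenvalue
  \<open>- 1\<close>, because \<open>V\<^sup>3 = V\<close>. On it the form of \<open>V P + P V\<close> is \<open>- 2\<close> times that of \<open>P\<close>, so \<open>P x = 0\<close> and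
  \<open>x = - V x = 0\<close>. Hence \<open>V\<^sup>2 = V\<close>, and \<open>T = V P = V\<^sup>* V P = P\<close>.\<close>

lemma positive_op_if_mean_transform:
  assumes T: "bounded_clinear T" and M: "positive_op (mean_transform T)"
  shows "positive_op T"
proof -
  define V P where "V = polar_isometry T" and "P = abs_op T"
  have V: "partial_isometry V"
    unfolding V_def by (rule partial_isometry_polar[OF T])
  note V' = partial_isometry_bounded_clinear[OF V]
  have P: "positive_op P"
    unfolding P_def by (rule positive_op_abs_op[OF T])
  note P' = positive_op_bounded_clinear[OF P]
  have T_eq: "T x = V (P x)" for x
    unfolding V_def P_def by (rule polar_decomposition[OF T, symmetric])
  have P_ker: "P x = 0 \<longleftrightarrow> V x = 0" for x
    unfolding V_def P_def by (simp add: polar_isometry_eq_zero_iff[OF T] abs_op_eq_zero_iff[OF T])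
  have M_eq: "mean_transform T x = (1/2) *\<^sub>C (T x + P (V x))" for x
    by (simp add: mean_transform_def V_def P_def)
  have "cadjoint V = V"
    unfolding V_def
  proof (rule polar_isometry_self_adjoint[OF T])
    show "cinner (T x + abs_op T (polar_isometry T x)) y
        = cinner x (T y + abs_op T (polar_isometry T y))" for x y
      using positive_op_cinner[OF M, of x y]
      by (simp add: M_eq cinner_scaleC_left cinner_scaleC_right V_def P_def)
  qed
  then have V_sym: "cinner (V x) y = cinner x (V y)" and cube: "V (V (V x)) = V x" for x y
    using cinner_cadjoint[OF V'] partial_isometry_cube[OF V] by simp_all
  have idem: "V (V y) = V y" for y
  proof -
    define x where "x = V y - V (V y)"
    have Vx: "V x = - x"
      by (simp add: x_def bounded_clinear_diff[OF V'] cube)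
    have neg: "P (- x) = - P x"
      using bounded_clinear_diff[OF P', of 0 x] bounded_clinear_zero[OF P'] by simp
    have "0 \<le> Re (cinner (T x + P (V x)) x)"
      using positive_op_nonneg[OF M, of x] by (simp add: M_eq cinner_scaleC_left)
    also have "cinner (T x + P (V x)) x = - 2 * cinner (P x) x"
      by (simp add: T_eq V_sym Vx neg cinner_diff_left cinner_minus_right)
    finally have "P x = 0"
      by (intro positive_op_form_zero[OF P]) simp
    then have "x = 0"
      using P_ker[of x] Vx by simp
    then show ?thesis
      by (simp add: x_def)
  qed
  have "T x = P x" for x
  proof -
    have "cinner (P x) z = 0" if "V z = 0" for z
      using that P_ker[of z] by (simp add: positive_op_cinner[OF P])
    then have "cadjoint V (V (P x)) = P x"
      by (rule partial_isometry_cadjoint_self[OF V])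
    then show ?thesis
      by (simp add: T_eq \<open>cadjoint V = V\<close> idem)
  qed
  then have "T = P" by (rule ext)
  with P show ?thesis by simp
qed

theorem theorem4p4:
  fixes T :: "'a::complex_hilbert \<Rightarrow> 'a"
  assumes "bounded_clinear T"
  shows "positive_op (mean_transform T) \<longleftrightarrow> positive_op T"
  using positive_op_if_mean_transform[OF assms] mean_transform_positive_op by metis

end
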